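(* Let $\rho\in[0,1)$, $\theta\in[0,1]$, $\sigma\in\mathbb{R}$, $k>0$ and $h>0$. If $$\frac{k}{h^2}\, f(\rho;\theta,\sigma) := \frac{k}{h^2}\left[1-2\left(\theta-\rho\sigma-\rho^2\right)\right] < 1,$$ then the $\theta$-$\sigma$ Milstein central difference scheme with time step $k$ and mesh size $h$ is stable in the mean-square sense for Fourier modes: for every $\phi\in[-\pi,\pi]$ with $\phi\neq 0$ and every solution of the scheme of the form $V_j^n = X_n \exp(i j\phi)$, $j\in\mathbb{Z}$, $n\ge 0$, one has $$\mathbb{E}\left[|X_n|^2\right]\to 0 \quad\text{as } n\to\infty .$$
   Context: The scheme discretises the SPDE $\mathrm{d}v = \frac12 \frac{\partial^2 v}{\partial x^2}\,\mathrm{d}t - \sqrt{\rho}\,\frac{\partial v}{\partial x}\,\mathrm{d}M_t$ on $\mathbb{R}$ (zero first-order drift, $\mu=0$), with $M$ a one-dimensional standard Brownian motion, on the infinite uniform grid $x_j=jh$, $j\in\mathbb{Z}$, with time step $k$. For a sequence $V=(V_j)_{j\in\mathbb{Z}}$ of complex numbers put $(D_1V)_j = V_{j+1}-V_{j-1}$ and $(D_2V)_j = V_{j+1}-2V_j+V_{j-1}$. Let $Z_0,Z_1,\dots$ be independent $N(0,1)$ random variables. The $\theta$-$\sigma$ Milstein central difference scheme for the sequences $V_n=(V_j^n)_{j\in\mathbb{Z}}$, $n\ge0$, is $$V_{n+1} = V_n + \theta\frac{k}{2h^2}D_2V_{n+1} + (1-\theta)\frac{k}{2h^2}D_2V_n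 - \sigma\frac{\rho k}{2h^2}D_2V_{n+1} - (1-\sigma)\frac{\rho k}{2h^2}D_2V_n - \frac{\sqrt{\rho k}\,Z_n}{2h}D_1V_n + \frac{\rho k Z_n^2}{2h^2}D_2V_n .$$ In the Fourier mode $V_j^n=X_n\exp(ij\phi)$, the amplitude $X_n$ is a complex-valued random variable not depending on $j$, $X_0\in\mathbb{C}$ is deterministic, and $X_n$ is a function of $X_0,Z_0,\dots,Z_{n-1}$. *)

theory Defs
  imports "HOL-Probability.Probability"
begin

definition D1 :: "(int \<Rightarrow> complex) \<Rightarrow> int \<Rightarrow> complex" where
  "D1 V j = V (j + 1) - V (j - 1)"

definition D2 :: "(int \<Rightarrow> complex) \<Rightarrow> int \<Rightarrow> complex" where
  "D2 V j = V (j + 1) - 2 * V j + V (j - 1)"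

(* V is the old time level, V' the new one, z the realised value of the normal variable.
   The step is a relation: V' also occurs on the right, and solvability is not presupposed. *)
definition milstein_step ::
  "real \<Rightarrow> real \<Rightarrow> real \<Rightarrow> real \<Rightarrow> real \<Rightarrow> real \<Rightarrow> (int \<Rightarrow> complex) \<Rightarrow> (int \<Rightarrow> complex) \<Rightarrow> bool" where
  "milstein_step \<rho> \<theta> \<sigma> k h z V V' \<longleftrightarrow>
     (\<forall>j. V' j = V j
        + of_real (\<theta> * (k / (2 * h\<^sup>2))) * D2 V' j
        + of_real ((1 - \<theta>) * (k / (2 * h\<^sup>2))) * D2 V j
        - of_real (\<sigma> * (\<rho> * k / (2 * h\<^sup>2))) * D2 V' j
        - of_real ((1 - \<sigma>) * (\<rho> * k / (2 * h\<^sup>2))) * D2 V j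
        - of_real (sqrt (\<rho> * k) * z / (2 * h)) * D1 V j
        + of_real (\<rho> * k * z\<^sup>2 / (2 * h\<^sup>2)) * D2 V j)"

(* V n \<omega> j is the value at time level n and grid point j * h.
   As usual for random variables, the equations are only required almost surely. *)
definition milstein_solution ::
  "'a measure \<Rightarrow> (nat \<Rightarrow> 'a \<Rightarrow> real) \<Rightarrow> real \<Rightarrow> real \<Rightarrow> real \<Rightarrow> real \<Rightarrow> real
     \<Rightarrow> (nat \<Rightarrow> 'a \<Rightarrow> int \<Rightarrow> complex) \<Rightarrow> bool" where
  "milstein_solution M Z \<rho> \<theta> \<sigma> k h V \<longleftrightarrow>
     (\<forall>n. AE \<omega> in M. milstein_step \<rho> \<theta> \<sigma> k h (Z n \<omega>) (V n \<omega>) (V (Suc n) \<omega>))"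

definition fourier_mode :: "real \<Rightarrow> (nat \<Rightarrow> 'a \<Rightarrow> complex) \<Rightarrow> nat \<Rightarrow> 'a \<Rightarrow> int \<Rightarrow> complex" where
  "fourier_mode \<phi> X n \<omega> j = X n \<omega> * exp (\<i> * of_int j * of_real \<phi>)"

(* The factor map g need not be measurable; only X n is. This is the weaker hypothesis. *)
definition amplitude ::
  "'a measure \<Rightarrow> (nat \<Rightarrow> 'a \<Rightarrow> real) \<Rightarrow> (nat \<Rightarrow> 'a \<Rightarrow> complex) \<Rightarrow> bool" where
  "amplitude M Z X \<longleftrightarrow>
     (\<exists>x\<^sub>0. \<forall>\<omega>\<in>space M. X 0 \<omega> = x\<^sub>0) \<and>
     (\<forall>n. X n \<in> borel_measurable M) \<and>
     (\<forall>n. \<exists>g. \<forall>\<omega>\<in>space M. X n \<omega> = g (X 0 \<omega>) (\<lambda>i\<in>{..<n}. Z i \<omega>))"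

(* Integrability is stated explicitly because the Bochner integral of a
   non-integrable function is 0 by convention. *)
definition mean_square_stable_fourier ::
  "'a measure \<Rightarrow> (nat \<Rightarrow> 'a \<Rightarrow> real) \<Rightarrow> real \<Rightarrow> real \<Rightarrow> real \<Rightarrow> real \<Rightarrow> real \<Rightarrow> bool" where
  "mean_square_stable_fourier M Z \<rho> \<theta> \<sigma> k h \<longleftrightarrow>
     (\<forall>\<phi>\<in>{-pi..pi} - {0}. \<forall>X.
        amplitude M Z X \<and> milstein_solution M Z \<rho> \<theta> \<sigma> k h (fourier_mode \<phi> X) \<longrightarrow>
        (\<forall>n. integrable M (\<lambda>\<omega>. (cmod (X n \<omega>))\<^sup>2)) \<and>
        (\<lambda>n. \<integral>\<omega>. (cmod (X n \<omega>))\<^sup>2 \<partial>M) \<longlonglongrightarrow> 0)"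

definition stability_f :: "real \<Rightarrow> real \<Rightarrow> real \<Rightarrow> real" where
  "stability_f \<rho> \<theta> \<sigma> = 1 - 2 * (\<theta> - \<rho> * \<sigma> - \<rho>\<^sup>2)"

end

theory Submission imports Defs begin

text \<open>In the Fourier mode \<open>\<phi>\<close>, with \<open>s = sin\<^sup>2 (\<phi>/2)\<close> and \<open>\<nu> = k / h\<^sup>2\<close>, the scheme reads
  \<open>a X\<^sub>n\<^sub>+\<^sub>1 = G(Z\<^sub>n) X\<^sub>n\<close> with the deterministic number \<open>a = 1 + 2 \<nu> s (\<theta> - \<rho>\<sigma>)\<close>.
  If \<open>a = 0\<close>, then \<open>\<rho> > 0\<close>, so \<open>G(Z\<^sub>n) \<noteq> 0\<close> almost surely and every \<open>X\<^sub>n\<close> vanishes almost surely.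
  Otherwise \<open>X\<^sub>n\<close> is a product of independent factors, and the moments \<open>E Z\<^sup>2 = 1\<close>, \<open>E Z\<^sup>4 = 3\<close> give
  \<open>E |G(Z)|\<^sup>2 = a\<^sup>2 + 4 \<nu> s (\<nu> s f - (1 - \<rho> (1 - s)))\<close>. Since \<open>\<nu> f < 1\<close> and
  \<open>s \<le> 1 - \<rho> (1 - s)\<close>, this is smaller than \<open>a\<^sup>2\<close>.\<close>

definition mode_denom :: "real \<Rightarrow> real \<Rightarrow> real \<Rightarrow> real \<Rightarrow> real \<Rightarrow> real" where
  "mode_denom \<rho> \<theta> \<sigma> \<nu> s = 1 + 2 * \<nu> * s * (\<theta> - \<rho> * \<sigma>)"

text \<open>This is the factor \<open>G(z)\<close>, given by real and imaginary part: on a Fourier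
  mode \<open>D2\<close> acts as a real number and \<open>D1\<close> as a purely imaginary
  one.\<close>

definition mode_numer :: "real \<Rightarrow> real \<Rightarrow> real \<Rightarrow> real \<Rightarrow> real \<Rightarrow> real \<Rightarrow> real \<Rightarrow> complex" where
  "mode_numer \<rho> \<theta> \<sigma> k h \<phi> z =
     Complex (1 - (k / h\<^sup>2) * (1 - cos \<phi>) * (1 - \<theta> - \<rho> * (1 - \<sigma>) + \<rho> * z\<^sup>2))
             (- (sqrt (\<rho> * k) * z / h * sin \<phi>))"

lemma D1_fourier_mode: "D1 (fourier_mode \<phi> X n \<omega>) 0 = X n \<omega> * (2 * \<i> * of_real (sin \<phi>))"
  by (simp add: D1_def fourier_mode_def complex_eq_iff Re_exp Im_exp algebra_simps)

lemma D2_fourier_mode: "D2 (fourier_mode \<phi> X n \<omega>) 0 = X n \<omega> * of_real (2 * cos \<phi> - 2)"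
  by (simp add: D2_def fourier_mode_def complex_eq_iff Re_exp Im_exp algebra_simps)

text \<open>The grid point \<open>j = 0\<close>, where the exponential is 1, already yields the
  scalar recursion. It stays undivided because \<open>mode_denom\<close> may vanish.\<close>

lemma milstein_step_fourier_mode:
  assumes "milstein_step \<rho> \<theta> \<sigma> k h z (fourier_mode \<phi> X n \<omega>) (fourier_mode \<phi> X m \<omega>)"
  shows "X m \<omega> * of_real (mode_denom \<rho> \<theta> \<sigma> (k / h\<^sup>2) ((1 - cos \<phi>) / 2))
       = X n \<omega> * mode_numer \<rho> \<theta> \<sigma> k h \<phi> z"
proof -
  have F0: "fourier_mode \<phi> X i \<omega> 0 = X i \<omega>" for i
    by (simp add: fourier_mode_def)
  note eq = assms(1)[unfolded milstein_step_def, rule_format, of 0, unfolded F0 D1_fourier_mode D2_fourier_mode]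
  define A where "A = k / (2 * h\<^sup>2)"
  define B where "B = sqrt (\<rho> * k) * z / (2 * h)"
  have A: "\<rho> * k / (2 * h\<^sup>2) = \<rho> * A" "\<rho> * k * z\<^sup>2 / (2 * h\<^sup>2) = \<rho> * z\<^sup>2 * A"
    by (simp_all add: A_def)
  have denom: "mode_denom \<rho> \<theta> \<sigma> (k / h\<^sup>2) ((1 - cos \<phi>) / 2)
      = 1 + 2 * A * (1 - cos \<phi>) * (\<theta> - \<rho> * \<sigma>)"
    by (simp add: mode_denom_def A_def)
  have numer: "mode_numer \<rho> \<theta> \<sigma> k h \<phi> z
      = Complex (1 - 2 * A * (1 - cos \<phi>) * (1 - \<theta> - \<rho> * (1 - \<sigma>) + \<rho> * z\<^sup>2)) (- (2 * B * sin \<phi>))"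
    by (simp add: mode_numer_def A_def B_def)
  show ?thesis
    using eq unfolding A A_def[symmetric] B_def[symmetric] denom numer
    by (simp add: complex_eq_iff algebra_simps)
qed

text \<open>The real part \<open>p - r * z\<^sup>2\<close> is even in \<open>z\<close> and the
  imaginary part is a multiple of \<open>z\<close>, so only even powers occur and the moments of
  order 2 and 4 suffice.\<close>

lemma cmod_mode_numer:
  fixes \<rho> \<theta> \<sigma> k h \<phi> z :: real
  assumes "\<rho> \<ge> 0" "k > 0" "h > 0"
  defines "\<nu> \<equiv> k / h\<^sup>2" and "s \<equiv> (1 - cos \<phi>) / 2"
  defines "p \<equiv> 1 - 2 * \<nu> * s * (1 - \<theta> - \<rho> * (1 - \<sigma>))" and "r \<equiv> 2 * \<nu> * s * \<rho>"
  shows "(cmod (mode_numer \<rho> \<theta> \<sigma> k h \<phi> z))\<^sup>2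
       = p\<^sup>2 + (4 * \<rho> * \<nu> * s * (1 - s) - 2 * p * r) * z ^ 2 + r\<^sup>2 * z ^ 4"
proof -
  have sin2: "(sin \<phi>)\<^sup>2 = 4 * s * (1 - s)"
    unfolding s_def sin_squared_eq by (simp add: field_simps power2_eq_square)
  have c: "1 - cos \<phi> = 2 * s"
    by (simp add: s_def)
  have re: "Re (mode_numer \<rho> \<theta> \<sigma> k h \<phi> z) = p - r * z\<^sup>2"
    unfolding mode_numer_def \<nu>_def[symmetric] c by (simp add: p_def r_def algebra_simps)
  have im: "(Im (mode_numer \<rho> \<theta> \<sigma> k h \<phi> z))\<^sup>2 = \<rho> * \<nu> * z\<^sup>2 * (4 * s * (1 - s))"
    using assms(1-3) unfolding sin2[symmetric]
    by (simp add: mode_numer_def \<nu>_def power_mult_distrib power_divide)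
  show ?thesis
    unfolding cmod_power2 re im by (simp add: algebra_simps power2_eq_square power4_eq_xxxx)
qed

lemma std_normal_moments:
  assumes "distributed M lborel Y std_normal_density"
  shows "integrable M (\<lambda>\<omega>. Y \<omega> ^ 2)" "(\<integral>\<omega>. Y \<omega> ^ 2 \<partial>M) = (1::real)"
    and "integrable M (\<lambda>\<omega>. Y \<omega> ^ 4)" "(\<integral>\<omega>. Y \<omega> ^ 4 \<partial>M) = (3::real)"
proof -
  have "has_bochner_integral lborel (\<lambda>x. std_normal_density x * x ^ 2) 1"
    using std_normal_moment_even[of 1] by simp
  \<comment> \<open>The even moment formula gives 4! / (2^2 * 2!) = 3.\<close>
  moreover have "has_bochner_integral lborel (\<lambda>x. std_normal_density x * x ^ 4) 3"
    using std_normal_moment_even[of 2] by (simp add: fact_numeral)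
  ultimately show "integrable M (\<lambda>\<omega>. Y \<omega> ^ 2)" "(\<integral>\<omega>. Y \<omega> ^ 2 \<partial>M) = 1"
    "integrable M (\<lambda>\<omega>. Y \<omega> ^ 4)" "(\<integral>\<omega>. Y \<omega> ^ 4 \<partial>M) = 3"
    using distributed_integrable[OF assms, of "\<lambda>x. x ^ 2"] distributed_integral[OF assms, of "\<lambda>x. x ^ 2"]
      distributed_integrable[OF assms, of "\<lambda>x. x ^ 4"] distributed_integral[OF assms, of "\<lambda>x. x ^ 4"]
    by (auto simp: has_bochner_integral_iff)
qed

text \<open>With the \<open>p\<close> and \<open>r\<close> of \<open>cmod_mode_numer\<close>, the
  moments 1 and 3 give \<open>(p - r)\<^sup>2 + 2 * r\<^sup>2 + 4 * \<rho> * \<nu> * s * (1 -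
  s)\<close>. Here \<open>p - r = a - 2 * \<nu> * s\<close>, where \<open>a\<close> is the value of
  \<open>mode_denom\<close>; expanding the square collects the rest into
  \<open>stability_f\<close>.\<close>

lemma (in prob_space) mode_numer_second_moment:
  fixes \<rho> \<theta> \<sigma> k h \<phi> :: real
  assumes "distributed M lborel Y std_normal_density" and "\<rho> \<ge> 0" "k > 0" "h > 0"
  defines "\<nu> \<equiv> k / h\<^sup>2" and "s \<equiv> (1 - cos \<phi>) / 2"
  shows "integrable M (\<lambda>\<omega>. (cmod (mode_numer \<rho> \<theta> \<sigma> k h \<phi> (Y \<omega>)))\<^sup>2)" (is ?int)
    and "expectation (\<lambda>\<omega>. (cmod (mode_numer \<rho> \<theta> \<sigma> k h \<phi> (Y \<omega>)))\<^sup>2)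
       = (mode_denom \<rho> \<theta> \<sigma> \<nu> s)\<^sup>2
         + 4 * \<nu> * s * (\<nu> * s * stability_f \<rho> \<theta> \<sigma> - (1 - \<rho> * (1 - s)))" (is ?ex)
proof -
  note m = std_normal_moments[OF assms(1)]
  note [simp] = cmod_mode_numer[OF assms(2-4)]
  show ?int
    using m(1,3) by simp
  show ?ex
    using m by (simp add: prob_space flip: \<nu>_def s_def)
      (simp add: mode_denom_def stability_f_def algebra_simps power2_eq_square)
qed

text \<open>At \<open>s = 1\<close>, the highest frequency, the bracket is
  \<open>\<nu> * f - 1\<close>, so the hypothesis on \<open>\<nu> * f\<close> is exactly what that
  mode demands.\<close>

lemma mode_contraction:
  fixes \<nu> s \<rho> f :: real
  assumes "\<nu> > 0" "0 < s" "s \<le> 1" "\<rho> < 1" "\<nu> * f < 1"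
  shows "4 * \<nu> * s * (\<nu> * s * f - (1 - \<rho> * (1 - s))) < 0"
proof -
  have "s * (\<nu> * f) < s * 1"
    using assms by (intro mult_strict_left_mono)
  \<comment> \<open>Expanded, this says \<open>s \<le> 1 - \<rho> * (1 - s)\<close>.\<close>
  moreover have "0 \<le> (1 - \<rho>) * (1 - s)"
    using assms by simp
  ultimately have "\<nu> * s * f < 1 - \<rho> * (1 - s)"
    by (simp add: algebra_simps)
  then show ?thesis
    using assms by (simp add: mult_pos_neg)
qed

text \<open>The real part is a quadratic in \<open>z\<close> with leading coefficient
  \<open>- r\<close>, which is nonzero. It has at most two real zeros, and a variable with a density
  avoids them almost surely.\<close>

lemma (in prob_space) mode_numer_AE_nonzero:
  assumes Y: "distributed M lborel Y std_normal_density"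
    and "\<rho> > 0" "k > 0" "h > 0" "cos \<phi> < 1"
  shows "AE \<omega> in M. mode_numer \<rho> \<theta> \<sigma> k h \<phi> (Y \<omega>) \<noteq> 0"
proof -
  define t where "t = k / h\<^sup>2 * (1 - cos \<phi>)"
  define r where "r = t * \<rho>"
  \<comment> \<open>The only value that \<open>z\<^sup>2\<close> can take at a zero of the real
    part. If it is negative there is no zero, and excluding the points \<open>sqrt q\<close> and
    \<open>- sqrt q\<close> does no harm.\<close>
  define q where "q = (1 - t * (1 - \<theta> - \<rho> * (1 - \<sigma>))) / r"
  have "r > 0"
    using assms by (simp add: r_def t_def)
  then have root: "z = sqrt q \<or> z = - sqrt q" if "mode_numer \<rho> \<theta> \<sigma> k h \<phi> z = 0" for z
  proof -
    have "r * q = 1 - t * (1 - \<theta> - \<rho> * (1 - \<sigma>))"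
      using \<open>r > 0\<close> by (simp add: q_def)
    then have "Re (mode_numer \<rho> \<theta> \<sigma> k h \<phi> z) = r * (q - z\<^sup>2)"
      unfolding mode_numer_def t_def[symmetric] by (simp add: r_def algebra_simps)
    then have "q = z\<^sup>2"
      using that \<open>r > 0\<close> by simp
    then show ?thesis
      by (auto simp: abs_if)
  qed
  have "AE z in lborel. z \<noteq> sqrt q \<and> z \<noteq> - sqrt q"
    using AE_lborel_singleton[of "sqrt q"] AE_lborel_singleton[of "- sqrt q"] by eventually_elim auto
  then have "AE \<omega> in M. Y \<omega> \<noteq> sqrt q \<and> Y \<omega> \<noteq> - sqrt q"
    by (subst distributed_AE2[OF Y]) auto
  then show ?thesis
    by eventually_elim (use root in blast)
qed

text \<open>Unrolling the recursion writes \<open>X n\<close> almost surely as \<open>x\<close>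
  times a product of independent factors, so the mean square is the geometric sequence
  \<open>(cmod x)\<^sup>2 * q ^ n\<close>.\<close>

lemma (in prob_space) product_mean_square_tendsto_0:
  fixes Z :: "nat \<Rightarrow> 'a \<Rightarrow> real" and G :: "real \<Rightarrow> complex"
  assumes indep: "indep_vars (\<lambda>_. borel) Z UNIV"
    and G: "G \<in> borel_measurable borel"
    and int: "\<And>n. integrable M (\<lambda>\<omega>. (cmod (G (Z n \<omega>)))\<^sup>2)"
    and ex: "\<And>n. expectation (\<lambda>\<omega>. (cmod (G (Z n \<omega>)))\<^sup>2) = q" and "q < 1"
    and X: "\<And>n. X n \<in> borel_measurable M"
    and X0: "AE \<omega> in M. X 0 \<omega> = x"
    and step: "\<And>n. AE \<omega> in M. X (Suc n) \<omega> = X n \<omega> * G (Z n \<omega>)"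
  shows "integrable M (\<lambda>\<omega>. (cmod (X n \<omega>))\<^sup>2)"
    and "(\<lambda>n. expectation (\<lambda>\<omega>. (cmod (X n \<omega>))\<^sup>2)) \<longlonglongrightarrow> 0"
proof -
  have Xn: "AE \<omega> in M. X n \<omega> = x * (\<Prod>i<n. G (Z i \<omega>))" for n
  proof (induction n)
    case 0
    then show ?case using X0 by simp
  next
    case (Suc n)
    with step[of n] show ?case
      by eventually_elim (simp add: mult.assoc)
  qed
  let ?P = "\<lambda>n \<omega>. (cmod x)\<^sup>2 * (\<Prod>i<n. (cmod (G (Z i \<omega>)))\<^sup>2)"
  have sq: "AE \<omega> in M. (cmod (X n \<omega>))\<^sup>2 = ?P n \<omega>" for n
    using Xn[of n]
    by eventually_elim (simp add: norm_mult power_mult_distrib prod_power_distrib flip: prod_norm)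
  have ind: "indep_vars (\<lambda>_. borel) (\<lambda>i \<omega>. (cmod (G (Z i \<omega>)))\<^sup>2) {..<n}" for n
    using indep_vars_compose2[OF indep_vars_subset[OF indep], of "{..<n}" "\<lambda>_ z. (cmod (G z))\<^sup>2" "\<lambda>_. borel"] G
    by simp
  have intP: "integrable M (?P n)" for n
    by (intro integrable_mult_right indep_vars_integrable[OF _ ind] int) auto
  have "expectation (\<lambda>\<omega>. \<Prod>i<n. (cmod (G (Z i \<omega>)))\<^sup>2) = q ^ n" for n
    using indep_vars_lebesgue_integral[OF _ ind[of n]] int ex by simp
  then have exP: "expectation (?P n) = (cmod x)\<^sup>2 * q ^ n" for n
    by simp
  \<comment> \<open>The product formula holds only almost surely; passing to \<open>X n\<close>
    under the integral therefore needs measurability of both sides.\<close>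
  have [measurable]: "X n \<in> borel_measurable M" for n by (rule X)
  have P [measurable]: "?P n \<in> borel_measurable M" for n
    by (rule borel_measurable_integrable[OF intP])
  show "integrable M (\<lambda>\<omega>. (cmod (X n \<omega>))\<^sup>2)"
    using intP[of n] by (subst integrable_cong_AE[OF _ P sq]) measurable
  have E: "expectation (\<lambda>\<omega>. (cmod (X n \<omega>))\<^sup>2) = (cmod x)\<^sup>2 * q ^ n" for n
    unfolding exP[symmetric] by (intro integral_cong_AE sq) measurable
  \<comment> \<open>Being the mean of a square, \<open>q\<close> also satisfies
    \<open>\<bar>q\<bar> < 1\<close>, as the geometric limit requires.\<close>
  have "q \<ge> 0"
    using ex[of 0] by (metis Bochner_Integration.integral_nonneg zero_le_power2)
  then show "(\<lambda>n. expectation (\<lambda>\<omega>. (cmod (X n \<omega>))\<^sup>2)) \<longlonglongrightarrow> 0"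
    unfolding E using \<open>q < 1\<close> by (intro tendsto_mult_right_zero LIMSEQ_power_zero) simp
qed

theorem theorem2p1:
  fixes M :: "'a measure" and Z :: "nat \<Rightarrow> 'a \<Rightarrow> real" and \<rho> \<theta> \<sigma> k h :: real
  assumes "prob_space M"
    and "prob_space.indep_vars M (\<lambda>_. borel) Z UNIV"
    and "\<And>n. distributed M lborel (Z n) std_normal_density"
    and "\<rho> \<in> {0..<1}" and "\<theta> \<in> {0..1}" and "k > 0" and "h > 0"
    and "k / h\<^sup>2 * stability_f \<rho> \<theta> \<sigma> < 1"
  shows "mean_square_stable_fourier M Z \<rho> \<theta> \<sigma> k h"
  unfolding mean_square_stable_fourier_def
proof (intro ballI allI impI)
  interpret prob_space M by fact
  fix \<phi> X
  assume \<phi>: "\<phi> \<in> {- pi..pi} - {0}"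
    and sol: "amplitude M Z X \<and> milstein_solution M Z \<rho> \<theta> \<sigma> k h (fourier_mode \<phi> X)"
  define \<nu> where "\<nu> = k / h\<^sup>2"
  define s where "s = (1 - cos \<phi>) / 2"
  define a where "a = mode_denom \<rho> \<theta> \<sigma> \<nu> s"
  define G where "G = mode_numer \<rho> \<theta> \<sigma> k h \<phi>"
  have \<nu>: "\<nu> > 0"
    using assms by (simp add: \<nu>_def)
  \<comment> \<open>The absolute value treats both signs of \<open>\<phi>\<close> at once, since
    \<open>cos\<close> is even and decreasing on \<open>{0..pi}\<close>.\<close>
  have "cos \<bar>\<phi>\<bar> < cos 0"
    using \<phi> by (intro cos_monotone_0_pi) auto
  then have cos: "cos \<phi> < 1"
    by simp
  have s: "0 < s" "s \<le> 1"
    using cos cos_ge_minus_one[of \<phi>] by (simp_all add: s_def)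
  from sol obtain x where x: "\<And>\<omega>. \<omega> \<in> space M \<Longrightarrow> X 0 \<omega> = x"
    and X: "\<And>n. X n \<in> borel_measurable M"
    by (auto simp: amplitude_def)
  have step: "AE \<omega> in M. X (Suc n) \<omega> * of_real a = X n \<omega> * G (Z n \<omega>)" for n
  proof -
    have "AE \<omega> in M. milstein_step \<rho> \<theta> \<sigma> k h (Z n \<omega>)
        (fourier_mode \<phi> X n \<omega>) (fourier_mode \<phi> X (Suc n) \<omega>)"
      using sol by (simp add: milstein_solution_def)
    then show ?thesis
      unfolding a_def G_def \<nu>_def s_def
      by eventually_elim (rule milstein_step_fourier_mode)
  qed
  have G: "G \<in> borel_measurable borel"
    unfolding G_def mode_numer_def Complex_eq by measurable
  show "(\<forall>n. integrable M (\<lambda>\<omega>. (cmod (X n \<omega>))\<^sup>2)) \<and>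
        (\<lambda>n. \<integral>\<omega>. (cmod (X n \<omega>))\<^sup>2 \<partial>M) \<longlonglongrightarrow> 0"
  proof (cases "a = 0")
    case True
    \<comment> \<open>For \<open>\<rho> = 0\<close>, the bound \<open>\<theta> \<ge> 0\<close> would
      give \<open>a \<ge> 1\<close>.\<close>
    have "\<rho> \<noteq> 0"
    proof
      assume "\<rho> = 0"
      then have "a = 1 + 2 * \<nu> * s * \<theta>" by (simp add: a_def mode_denom_def)
      moreover have "0 \<le> 2 * \<nu> * s * \<theta>" using \<nu> s assms(5) by simp
      ultimately show False using True by simp
    qed
    then have "\<rho> > 0"
      using assms(4) by simp
    \<comment> \<open>With \<open>a = 0\<close> the step equation no longer determines
      \<open>X (Suc n)\<close>; it forces \<open>X n \<omega> * G (Z n \<omega>) = 0\<close>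
      instead.\<close>
    have "AE \<omega> in M. (cmod (X n \<omega>))\<^sup>2 = 0" for n
      using step[of n] mode_numer_AE_nonzero[OF assms(3)[of n] \<open>\<rho> > 0\<close> assms(6,7) cos, where \<theta> = \<theta> and \<sigma> = \<sigma>]
      by eventually_elim (simp add: True G_def)
    moreover have "(\<lambda>\<omega>. (cmod (X n \<omega>))\<^sup>2) \<in> borel_measurable M" for n
      using X[of n] by measurable
    ultimately show ?thesis
      by (simp add: integrable_cong_AE[of _ M "\<lambda>_. 0"] integral_cong_AE[of _ M "\<lambda>_. 0"])
  next
    case False
    \<comment> \<open>The mean-square amplification per step, the second moment of
      \<open>G (Z n \<omega>) / a\<close>.\<close>
    define q where "q = (a\<^sup>2 + 4 * \<nu> * s * (\<nu> * s * stability_f \<rho> \<theta> \<sigma> - (1 - \<rho> * (1 - s)))) / a\<^sup>2"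
    have "q < 1"
      using mode_contraction[OF \<nu> s, of \<rho> "stability_f \<rho> \<theta> \<sigma>"] assms(4,8) False
      by (simp add: q_def \<nu>_def)
    have "\<rho> \<ge> 0" using assms(4) by simp
    note mom = mode_numer_second_moment[OF assms(3) \<open>\<rho> \<ge> 0\<close> assms(6,7), where \<theta> = \<theta> and \<sigma> = \<sigma> and \<phi> = \<phi>,
        folded G_def \<nu>_def s_def, folded a_def]
    let ?H = "\<lambda>z. G z / of_real a"
    have H: "?H \<in> borel_measurable borel"
      using G by measurable
    have int: "integrable M (\<lambda>\<omega>. (cmod (?H (Z n \<omega>)))\<^sup>2)" for n
      using mom(1)[of n] by (simp add: norm_divide power_divide)
    have ex: "expectation (\<lambda>\<omega>. (cmod (?H (Z n \<omega>)))\<^sup>2) = q" for n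
      using mom(2)[of n] by (simp add: norm_divide power_divide q_def)
    have X0: "AE \<omega> in M. X 0 \<omega> = x"
      using x by (intro AE_I2)
    have "AE \<omega> in M. X (Suc n) \<omega> = X n \<omega> * ?H (Z n \<omega>)" for n
      using step[of n] by eventually_elim (use False in \<open>simp add: field_simps\<close>)
    from product_mean_square_tendsto_0[OF assms(2) H int ex \<open>q < 1\<close> X X0 this]
    show ?thesis by blast
  qed
qed

end
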